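(* Let $f:\mathbb{C}^n\to\mathbb{C}^n$ be a polynomial map such that the set $\mathrm{Pre}(f)$ of preperiodic points of $f$ is of bounded height and Zariski dense in $\mathbb{A}^n$. Then for every $d\ge1$ the set \[ \mathrm{Com}(f,d)=\{g:\mathbb{A}^n\to\mathbb{A}^n \text{ polynomial map} : f\circ g=g\circ f,\ \deg g=d\} \] is finite.
   Context: $\mathrm{Pre}(f)=\{P : f^m(P)=f^l(P)\text{ for some integers } m>l\ge0\}$. "Bounded height" means: $f$ is defined over a field $K$ finitely generated over $\mathbb{Q}$, $\mathrm{Pre}(f)\subset\mathbb{A}^n(\overline{K})\subset\mathbb{P}^n(\overline{K})$, and $\sup_{P\in\mathrm{Pre}(f)}h(P)<\infty$, where $h$ is an arithmetic height function on $\mathbb{P}^n(\overline{K})$ associated with an ample line bundle on $\mathbb{P}^n$ (and, when $K$ is not a number field, a nef and big polarization of $K$ in the sense of Moriwaki). The degree of a polynomial map is the maximum total degree of its coordinate polynomials. *)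

theory Defs
  imports
    "HOL-Analysis.Analysis"
    "HOL-Algebra.Algebraic_Closure_Type"
    "HOL-Algebra.Generated_Fields"
    "HOL-Combinatorics.Permutations"
    "HOL-Library.Poly_Mapping"
begin

section \<open>Multivariate polynomials and polynomial maps\<close>

type_synonym ('v, 'a) mp = "('v \<Rightarrow>\<^sub>0 nat) \<Rightarrow>\<^sub>0 'a"

definition mp_eval :: "('v \<Rightarrow> 'a) \<Rightarrow> ('v, 'a) mp \<Rightarrow> 'a::comm_semiring_1" where
  "mp_eval z F = (\<Sum>m\<in>Poly_Mapping.keys F.
     Poly_Mapping.lookup F m * (\<Prod>v\<in>Poly_Mapping.keys m. z v ^ Poly_Mapping.lookup m v))"

definition evalZ :: "('v \<Rightarrow> complex) \<Rightarrow> ('v, int) mp \<Rightarrow> complex" where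
  "evalZ z F = mp_eval z (Poly_Mapping.map of_int F)"

definition indet :: "'v \<Rightarrow> ('v, int) mp" where
  "indet v = Poly_Mapping.single (Poly_Mapping.single v 1) 1"

definition total_degree :: "('v, 'a::zero) mp \<Rightarrow> nat" where
  "total_degree F = Max (insert 0
     ((\<lambda>m. \<Sum>v\<in>Poly_Mapping.keys m. Poly_Mapping.lookup m v) ` Poly_Mapping.keys F))"

definition poly_map :: "('n \<Rightarrow> ('n::finite, complex) mp) \<Rightarrow> complex^'n \<Rightarrow> complex^'n" where
  "poly_map F x = (\<chi> i. mp_eval (($) x) (F i))"

definition polynomial_map :: "(complex^'n::finite \<Rightarrow> complex^'n) \<Rightarrow> bool" where
  "polynomial_map f \<longleftrightarrow> (\<exists>F. f = poly_map F)"

definition tuple_degree :: "('n::finite \<Rightarrow> ('n, complex) mp) \<Rightarrow> nat" where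
  "tuple_degree F = Max (range (\<lambda>i. total_degree (F i)))"

definition Pre :: "('a \<Rightarrow> 'a) \<Rightarrow> 'a set" where
  "Pre f = {P. \<exists>m l. m > l \<and> (f ^^ m) P = (f ^^ l) P}"

text \<open>A polynomial map of complex affine space has exactly one coordinate tuple, so the degree
  may be read off from any tuple that represents it.\<close>

definition Com :: "(complex^'n::finite \<Rightarrow> complex^'n) \<Rightarrow> nat \<Rightarrow> (complex^'n \<Rightarrow> complex^'n) set" where
  "Com f d = {g. f \<circ> g = g \<circ> f \<and> (\<exists>G. g = poly_map G \<and> tuple_degree G = d)}"

definition zariski_closed :: "(complex^'n::finite) set \<Rightarrow> bool" where
  "zariski_closed Z \<longleftrightarrow> (\<exists>S. Z = {x. \<forall>p\<in>S. mp_eval (($) x) p = 0})"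

definition zariski_dense :: "(complex^'n::finite) set \<Rightarrow> bool" where
  "zariski_dense A \<longleftrightarrow> (\<forall>Z. zariski_closed Z \<and> A \<subseteq> Z \<longrightarrow> Z = UNIV)"

section \<open>Finitely generated fields\<close>

text \<open>All fields are realised as subfields of the complex numbers.\<close>

abbreviation CC :: "complex ring" where
  "CC \<equiv> ring_of_type_algebra"

text \<open>In characteristic zero the generated subfield contains the rationals.\<close>

definition fin_gen_field :: "complex set \<Rightarrow> bool" where
  "fin_gen_field K \<longleftrightarrow> (\<exists>S. finite S \<and> K = generate_field CC S)"

definition alg_closure_in_C :: "complex set \<Rightarrow> complex set" where
  "alg_closure_in_C K = {x. (ring.algebraic CC over K) x}"

definition alg_indep :: "complex set \<Rightarrow> bool" where
  "alg_indep A \<longleftrightarrow> (\<forall>F. (\<forall>m\<in>Poly_Mapping.keys F. Poly_Mapping.keys m \<subseteq> A) \<and>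
     evalZ (\<lambda>v. v) F = 0 \<longrightarrow> F = 0)"

definition trdeg :: "complex set \<Rightarrow> nat" where
  "trdeg K = Sup {card A | A. finite A \<and> A \<subseteq> K \<and> alg_indep A}"

section \<open>Integral closed subschemes of products of projective spaces over the integers\<close>

text \<open>
  The variable \<open>(j, i)\<close> is the \<open>i\<close>-th homogeneous coordinate of the \<open>j\<close>-th projective space, and
  \<open>j\<close> ranges over the blocks \<open>j < r\<close>.  There are infinitely many variables; the number of
  coordinates in each block is finite because every subscheme that occurs below lies in one on
  which all but finitely many coordinates vanish.  Integral closed subschemes, equivalently
  scheme-theoretic points, are the multihomogeneous primes which contain no complete block of
  variables.
\<close>

type_synonym zpoly = "(nat \<times> nat, int) mp"
type_synonym point = "nat \<times> nat \<Rightarrow> complex"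

abbreviation ZX :: "zpoly ring" where
  "ZX \<equiv> ring_of_type_algebra"

definition mdeg :: "(nat \<times> nat \<Rightarrow>\<^sub>0 nat) \<Rightarrow> nat \<Rightarrow> nat" where
  "mdeg m j = (\<Sum>v\<in>{v\<in>Poly_Mapping.keys m. fst v = j}. Poly_Mapping.lookup m v)"

definition mhom :: "(nat \<Rightarrow> nat) \<Rightarrow> zpoly \<Rightarrow> bool" where
  "mhom \<delta> F \<longleftrightarrow> (\<forall>m\<in>Poly_Mapping.keys F. mdeg m = \<delta>)"

definition mhom_component :: "(nat \<Rightarrow> nat) \<Rightarrow> zpoly \<Rightarrow> zpoly" where
  "mhom_component \<delta> F = (\<Sum>m\<in>{m\<in>Poly_Mapping.keys F. mdeg m = \<delta>}.
     Poly_Mapping.single m (Poly_Mapping.lookup F m))"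

definition subscheme :: "nat \<Rightarrow> zpoly set \<Rightarrow> bool" where
  "subscheme r P \<longleftrightarrow> primeideal P ZX \<and>
     (\<forall>F\<in>P. \<forall>\<delta>. mhom_component \<delta> F \<in> P) \<and>
     (\<forall>j<r. \<exists>i. indet (j, i) \<notin> P)"

definition prime_divisor :: "nat \<Rightarrow> zpoly set \<Rightarrow> zpoly set \<Rightarrow> bool" where
  "prime_divisor r P Q \<longleftrightarrow> subscheme r Q \<and> P \<subset> Q \<and>
     \<not> (\<exists>U. subscheme r U \<and> P \<subset> U \<and> U \<subset> Q)"

definition closed_point :: "nat \<Rightarrow> zpoly set \<Rightarrow> bool" where
  "closed_point r P \<longleftrightarrow> subscheme r P \<and> \<not> (\<exists>Q. subscheme r Q \<and> P \<subset> Q)"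

definition one_dimensional :: "nat \<Rightarrow> zpoly set \<Rightarrow> bool" where
  "one_dimensional r P \<longleftrightarrow> subscheme r P \<and> \<not> closed_point r P \<and>
     (\<forall>Q. subscheme r Q \<and> P \<subset> Q \<longrightarrow> closed_point r Q)"

text \<open>
  Order of vanishing along \<open>Q\<close> of a multihomogeneous \<open>F\<close> on the scheme of \<open>P\<close>: the length of the
  local ring modulo \<open>P\<close> and \<open>F\<close>.  Ideals of the localisation at \<open>Q\<close> correspond to ideals \<open>I\<close> of
  the polynomial ring with \<open>s * a \<in> I \<Longrightarrow> a \<in> I\<close> for all \<open>s \<notin> Q\<close>.  Localising at all elements
  outside \<open>Q\<close>, not just at the multihomogeneous ones, does not change the length.
\<close>

definition ord_along :: "zpoly set \<Rightarrow> zpoly set \<Rightarrow> zpoly \<Rightarrow> nat" where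
  "ord_along P Q F = Sup {k. \<exists>I :: nat \<Rightarrow> zpoly set.
     (\<forall>i\<le>k. ideal (I i) ZX \<and> insert F P \<subseteq> I i \<and>
        (\<forall>a s. s \<notin> Q \<and> s * a \<in> I i \<longrightarrow> a \<in> I i)) \<and>
     (\<forall>i<k. I i \<subset> I (Suc i))}"

text \<open>The residue field: fractions of multidegree zero modulo \<open>P\<close>.\<close>

definition residue_field :: "zpoly set \<Rightarrow> (zpoly \<times> zpoly) set set" where
  "residue_field P =
     (let A = {(F, G). G \<notin> P \<and> (\<exists>\<delta>. mhom \<delta> F \<and> mhom \<delta> G)}
      in A // {((F, G), (F', G')). (F, G) \<in> A \<and> (F', G') \<in> A \<and> F * G' - F' * G \<in> P})"

definition scale :: "(nat \<Rightarrow> complex) \<Rightarrow> point \<Rightarrow> point" where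
  "scale l z = (\<lambda>(j, i). l j * z (j, i))"

text \<open>The Zariski closure, over the integers, of the point with multihomogeneous coordinates \<open>b\<close>.\<close>

definition closure_prime :: "point \<Rightarrow> zpoly set" where
  "closure_prime b = {F. \<forall>l. evalZ (scale l b) F = 0}"

definition cone :: "nat \<Rightarrow> zpoly set \<Rightarrow> point set" where
  "cone r P = {z. (\<forall>F\<in>P. evalZ z F = 0) \<and> (\<forall>j<r. \<exists>i. z (j, i) \<noteq> 0)}"

definition chart :: "nat \<Rightarrow> zpoly set \<Rightarrow> (nat \<Rightarrow> nat) \<Rightarrow> point set" where
  "chart r P c = {z. (\<forall>F\<in>P. evalZ z F = 0) \<and> (\<forall>j<r. z (j, c j) = 1)}"

section \<open>Hermitian line bundles\<close>

text \<open>
  A pair \<open>(\<alpha>, \<phi>)\<close> stands for the restriction of \<open>O(\<alpha>)\<close>, with \<open>\<alpha>\<close> a possibly negative multidegree,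
  carrying the metric \<open>norm s z = \<bar>s z\<bar> * exp (- \<phi> z)\<close>, where \<open>\<phi>\<close> is a function on the
  multicone over the complex points.  This is no restriction: if \<open>A\<close> and the \<open>A + L_i\<close> are very
  ample, then in the embedding given by all these bundles each \<open>L_i\<close> has multidegree \<open>e_i - e_0\<close>.
\<close>

type_synonym hlb = "(nat \<Rightarrow> int) \<times> (point \<Rightarrow> real)"

definition pd :: "'v \<Rightarrow> complex \<Rightarrow> (('v \<Rightarrow> complex) \<Rightarrow> real) \<Rightarrow> ('v \<Rightarrow> complex) \<Rightarrow> real" where
  "pd v c g z = deriv (\<lambda>s::real. g (z(v := z v + of_real s * c))) 0"

primrec Ck :: "nat \<Rightarrow> ('v \<Rightarrow> complex) set \<Rightarrow> (('v \<Rightarrow> complex) \<Rightarrow> real) \<Rightarrow> bool" where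
  "Ck 0 U g \<longleftrightarrow> continuous_on U g"
| "Ck (Suc k) U g \<longleftrightarrow> continuous_on U g \<and>
     (\<forall>v. \<forall>c\<in>{1, \<i>}.
        (\<forall>z\<in>U. (\<lambda>s::real. g (z(v := z v + of_real s * c))) differentiable (at 0)) \<and>
        Ck k U (pd v c g))"

text \<open>Smoothness on a possibly singular space: local extension to a smooth ambient function.\<close>

definition smooth_on_cone :: "point set \<Rightarrow> (point \<Rightarrow> real) \<Rightarrow> bool" where
  "smooth_on_cone Z \<phi> \<longleftrightarrow>
     (\<forall>z\<in>Z. \<exists>U g. open U \<and> z \<in> U \<and> (\<forall>k. Ck k U g) \<and> (\<forall>w\<in>U \<inter> Z. g w = \<phi> w))"

definition hermitian_line_bundle :: "nat \<Rightarrow> zpoly set \<Rightarrow> hlb \<Rightarrow> bool" where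
  "hermitian_line_bundle r P = (\<lambda>(\<alpha>, \<phi>).
     (\<forall>j\<ge>r. \<alpha> j = 0) \<and>
     (\<forall>z\<in>cone r P. \<forall>l. (\<forall>j<r. l j \<noteq> 0) \<longrightarrow>
        \<phi> (scale l z) = \<phi> z + (\<Sum>j<r. of_int (\<alpha> j) * ln (cmod (l j)))) \<and>
     (\<forall>z\<in>cone r P. \<phi> (\<lambda>v. cnj (z v)) = \<phi> z) \<and>
     smooth_on_cone (cone r P) \<phi>)"

text \<open>The entry \<open>(a, b)\<close> of the Levi form, i.e. the derivative by \<open>t_a\<close> and the conjugate of \<open>t_b\<close>.\<close>

definition levi :: "((nat \<Rightarrow> complex) \<Rightarrow> real) \<Rightarrow> (nat \<Rightarrow> complex) \<Rightarrow> nat \<Rightarrow> nat \<Rightarrow> complex" where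
  "levi g t a b = Complex
     ((pd a 1 (pd b 1 g) t + pd a \<i> (pd b \<i> g) t) / 4)
     ((pd a 1 (pd b \<i> g) t - pd a \<i> (pd b 1 g) t) / 4)"

text \<open>
  The first Chern form of \<open>(\<alpha>, \<phi>)\<close> is \<open>(i / \<pi>)\<close> times the Levi form of \<open>\<phi>\<close>.  Hence the following is
  the density with respect to Lebesgue measure, \<open>i dt \<and> d(cnj t) = 2 dx \<and> dy\<close>, of the product of
  \<open>k\<close> such forms with local weights \<open>gs\<close>.
\<close>

definition chern_density :: "((nat \<Rightarrow> complex) \<Rightarrow> real) list \<Rightarrow> (nat \<Rightarrow> complex) \<Rightarrow> real" where
  "chern_density gs t = (let k = length gs in
     (2 / pi) ^ k * Re (\<Sum>\<sigma> | \<sigma> permutes {..<k}. \<Sum>\<tau> | \<tau> permutes {..<k}.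
        of_int (sign \<sigma> * sign \<tau>) * (\<Prod>l<k. levi (gs ! l) t (\<sigma> l) (\<tau> l))))"

text \<open>
  \<open>k\<close> coordinates \<open>T 0, \<dots>, T (k - 1)\<close> which are algebraically independent on the scheme of \<open>P\<close>.  If
  \<open>k\<close> is the dimension of the generic fibre, they map the chart to \<open>C^k\<close>, and outside a null set
  of \<open>C^k\<close> this map is a finite covering.
\<close>

definition indep_coords :: "nat \<Rightarrow> zpoly set \<Rightarrow> (nat \<Rightarrow> nat) \<Rightarrow> nat \<Rightarrow> (nat \<Rightarrow> nat \<times> nat) \<Rightarrow> bool" where
  "indep_coords r P c k T \<longleftrightarrow> inj_on T {..<k} \<and>
     (\<forall>F. F \<noteq> 0 \<and> (\<forall>m\<in>Poly_Mapping.keys F. Poly_Mapping.keys m \<subseteq> T ` {..<k}) \<longrightarrow>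
        (\<exists>z\<in>chart r P c. evalZ z F \<noteq> 0))"

text \<open>The sheet through \<open>z\<close> of that covering.\<close>

definition local_sheet ::
  "nat \<Rightarrow> zpoly set \<Rightarrow> (nat \<Rightarrow> nat) \<Rightarrow> nat \<Rightarrow> (nat \<Rightarrow> nat \<times> nat) \<Rightarrow> (nat \<Rightarrow> complex) \<Rightarrow> point
     \<Rightarrow> (nat \<Rightarrow> complex) \<Rightarrow> point" where
  "local_sheet r P c k T t z = (SOME s. s t = z \<and> (\<exists>\<epsilon>>0.
     let N = {u. (\<forall>i<k. cmod (u i - t i) < \<epsilon>) \<and> (\<forall>i\<ge>k. u i = t i)} in
     continuous_on N s \<and> (\<forall>u\<in>N. s u \<in> chart r P c \<and> (\<forall>i<k. s u (T i) = u i))))"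

text \<open>
  The integral over the complex points of \<open>\<phi> c_1(\<psi>_1) \<dots> c_1(\<psi>_k)\<close>, where \<open>\<phi>\<close> is taken on the
  chart \<open>c\<close>.  The complement of the chart and the singular points are null sets.  The set of
  complex points is empty for schemes over a finite field.
\<close>

definition arch_integral ::
  "nat \<Rightarrow> zpoly set \<Rightarrow> (nat \<Rightarrow> nat) \<Rightarrow> (point \<Rightarrow> real) \<Rightarrow> (point \<Rightarrow> real) list \<Rightarrow> real" where
  "arch_integral r P c \<phi> \<psi>s = (let k = length \<psi>s; T = (SOME T. indep_coords r P c k T) in
     integral\<^sup>L (PiM {..<k} (\<lambda>_. lborel)) (\<lambda>t.
       \<Sum>z\<in>{z\<in>chart r P c. \<forall>i<k. z (T i) = t i}.
         \<phi> z * chern_density (map (\<lambda>\<psi> u. \<psi> (local_sheet r P c k T t z u)) \<psi>s) t))"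

text \<open>
  The arithmetic intersection number of hermitian line bundles \<open>L_1, \<dots>, L_k\<close> on a scheme of
  dimension \<open>k\<close>.  For the rational section \<open>s\<close> of \<open>L_1\<close> given by the monomial in the variables
  \<open>(j, c j)\<close> with exponents \<open>\<alpha> j\<close>, it is
  \<open>\<Sum>Q. ord_Q(s) * deg(L_2 \<dots> L_k | Q) - \<integral> log \<parallel>s\<parallel> c_1(L_2) \<dots> c_1(L_k)\<close>, and
  \<open>- log \<parallel>s\<parallel> = \<phi>\<close> on the chart \<open>c\<close>.  It does not depend on the choice of \<open>c\<close>.
\<close>

primrec arith_deg :: "nat \<Rightarrow> hlb list \<Rightarrow> zpoly set \<Rightarrow> real" where
  "arith_deg r [] P = ln (real (card (residue_field P)))"
| "arith_deg r (L # Ls) P = (let c = (SOME c. \<forall>j<r. indet (j, c j) \<notin> P) in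
     Sum_any (\<lambda>Q. if prime_divisor r P Q
       then (\<Sum>j<r. of_int (fst L j) * real (ord_along P Q (indet (j, c j)))) * arith_deg r Ls Q
       else 0)
     + arch_integral r P c (snd L) (map snd Ls))"

definition semipositive :: "nat \<Rightarrow> zpoly set \<Rightarrow> hlb \<Rightarrow> bool" where
  "semipositive r P L \<longleftrightarrow> (\<forall>u :: complex \<Rightarrow> point.
     (\<forall>v. (\<lambda>s. u s v) holomorphic_on ball 0 1) \<and> (\<forall>s\<in>ball 0 1. u s \<in> cone r P) \<longrightarrow>
     Re (levi (\<lambda>t. snd L (u (t 0))) (\<lambda>_. 0) 0 0) \<ge> 0)"

definition nef :: "nat \<Rightarrow> zpoly set \<Rightarrow> hlb \<Rightarrow> bool" where
  "nef r P L \<longleftrightarrow> semipositive r P L \<and>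
     (\<forall>Q. one_dimensional r Q \<and> P \<subseteq> Q \<longrightarrow> arith_deg r [L] Q \<ge> 0)"

section \<open>Polarizations of finitely generated fields in the sense of Moriwaki\<close>

text \<open>
  A projective arithmetic variety with function field \<open>K\<close> is given by the multihomogeneous
  coordinates \<open>b\<close> of its generic point; its rational sections are then represented by their value
  at \<open>b\<close>.  The next predicate says that \<open>F / G\<close> represents the rational section \<open>x\<close> of \<open>O(\<alpha>)\<close> and
  has no pole at \<open>Q\<close>.
\<close>

definition represents ::
  "point \<Rightarrow> zpoly set \<Rightarrow> (nat \<Rightarrow> int) \<Rightarrow> complex \<Rightarrow> zpoly \<Rightarrow> zpoly \<Rightarrow> bool" where
  "represents b Q \<alpha> x F G \<longleftrightarrow> G \<notin> Q \<and> evalZ b F = x * evalZ b G \<and>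
     (\<exists>\<delta> \<delta>'. mhom \<delta> F \<and> mhom \<delta>' G \<and> (\<forall>j. int (\<delta> j) = int (\<delta>' j) + \<alpha> j))"

definition local_ring :: "point \<Rightarrow> zpoly set \<Rightarrow> complex set" where
  "local_ring b Q = {x. \<exists>F G. represents b Q (\<lambda>_. 0) x F G}"

definition global_sections :: "nat \<Rightarrow> point \<Rightarrow> (nat \<Rightarrow> int) \<Rightarrow> complex set" where
  "global_sections r b \<alpha> = {x. \<forall>Q. subscheme r Q \<and> closure_prime b \<subseteq> Q \<longrightarrow>
     (\<exists>F G. represents b Q \<alpha> x F G)}"

definition Z_rank :: "complex set \<Rightarrow> nat" where
  "Z_rank M = Sup {card A | A. finite A \<and> A \<subseteq> M \<and>
     (\<forall>k :: complex \<Rightarrow> int. (\<Sum>a\<in>A. of_int (k a) * a) = 0 \<longrightarrow> (\<forall>a\<in>A. k a = 0))}"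

definition big :: "nat \<Rightarrow> point \<Rightarrow> nat \<Rightarrow> hlb \<Rightarrow> bool" where
  "big r b e L \<longleftrightarrow>
     (\<exists>c>0. \<forall>\<^sub>F m in sequentially.
        real (Z_rank (global_sections r b (\<lambda>j. int m * fst L j))) \<ge> c * real m ^ e) \<and>
     (\<exists>m>0. \<exists>x\<in>global_sections r b (\<lambda>j. int m * fst L j). x \<noteq> 0 \<and>
        (\<exists>\<rho><1. \<forall>F G. represents b (closure_prime b) (\<lambda>j. int m * fst L j) x F G \<longrightarrow>
           (\<forall>z\<in>cone r (closure_prime b).
              cmod (evalZ z F) \<le> \<rho> * cmod (evalZ z G) * exp (real m * snd L z))))"

definition arithmetic_variety :: "complex set \<Rightarrow> nat \<Rightarrow> point \<Rightarrow> bool" where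
  "arithmetic_variety K r b \<longleftrightarrow>
     finite {v. b v \<noteq> 0} \<and> (\<forall>j i. b (j, i) \<noteq> 0 \<longrightarrow> j < r) \<and> (\<forall>j<r. \<exists>i. b (j, i) \<noteq> 0) \<and>
     generate_field CC {b (j, i) / b (j, i') | j i i'. b (j, i') \<noteq> 0} = K"

definition normal_variety :: "complex set \<Rightarrow> nat \<Rightarrow> point \<Rightarrow> bool" where
  "normal_variety K r b \<longleftrightarrow> (\<forall>Q. subscheme r Q \<and> closure_prime b \<subseteq> Q \<longrightarrow>
     (\<forall>x\<in>K. \<forall>p :: complex poly. poly.coeff p (Polynomial.degree p) = 1 \<and>
        (\<forall>i. poly.coeff p i \<in> local_ring b Q) \<and>
        poly p x = 0 \<longrightarrow> x \<in> local_ring b Q))"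

text \<open>For a number field \<open>K\<close> the list of line bundles is empty and the variety is the spectrum of
  the ring of integers.\<close>

definition nef_big_polarization :: "complex set \<Rightarrow> nat \<Rightarrow> point \<Rightarrow> hlb list \<Rightarrow> bool" where
  "nef_big_polarization K r b Hs \<longleftrightarrow>
     arithmetic_variety K r b \<and> normal_variety K r b \<and> length Hs = trdeg K \<and>
     (\<forall>H\<in>set Hs. hermitian_line_bundle r (closure_prime b) H \<and>
        nef r (closure_prime b) H \<and> big r b (trdeg K) H)"

section \<open>Arithmetic heights on projective space\<close>

text \<open>Points are represented by homogeneous coordinates \<open>y 0, \<dots>, y n\<close>.\<close>

definition hom_coords :: "complex set \<Rightarrow> nat \<Rightarrow> (nat \<Rightarrow> complex) set" where
  "hom_coords K n = {y. (\<exists>i. y i \<noteq> 0) \<and> (\<forall>i>n. y i = 0) \<and> range y \<subseteq> alg_closure_in_C K}"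

text \<open>The point \<open>(b, y)\<close> of the product with projective space as block \<open>r\<close>, and the pullback to
  this product.\<close>

definition join_block :: "nat \<Rightarrow> point \<Rightarrow> (nat \<Rightarrow> complex) \<Rightarrow> point" where
  "join_block r b y = (\<lambda>(j, i). if j < r then b (j, i) else if j = r then y i else 0)"

definition pullback :: "nat \<Rightarrow> hlb \<Rightarrow> hlb" where
  "pullback r L = (\<lambda>j. if j < r then fst L j else 0,
     \<lambda>z. snd L (\<lambda>(j, i). if j < r then z (j, i) else 0))"

definition fubini_study :: "nat \<Rightarrow> nat \<Rightarrow> hlb" where
  "fubini_study r n = (\<lambda>j. if j = r then 1 else 0,
     \<lambda>z. ln (\<Sum>i\<le>n. (cmod (z (r, i)))\<^sup>2) / 2)"

text \<open>The height of Moriwaki with respect to the model consisting of projective space over the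
  arithmetic variety and \<open>O(1)\<close> with the Fubini-Study metric: the arithmetic degree on the
  closure of the point, divided by the degree of the field of definition.\<close>

definition moriwaki_height ::
  "complex set \<Rightarrow> nat \<Rightarrow> point \<Rightarrow> hlb list \<Rightarrow> nat \<Rightarrow> (nat \<Rightarrow> complex) \<Rightarrow> real" where
  "moriwaki_height K r b Hs n y =
     arith_deg (Suc r) (fubini_study r n # map (pullback r) Hs) (closure_prime (join_block r b y))
     / real ((ring.dim CC over K)
         (generate_field CC (K \<union> {y i / y i' | i i'. y i' \<noteq> 0})))"

text \<open>
  A height associated with an ample line bundle \<open>O(k)\<close>, \<open>k \<ge> 1\<close>, is determined up to a bounded
  function (which comes from the choice of the model).
\<close>

definition ample_height ::
  "complex set \<Rightarrow> nat \<Rightarrow> point \<Rightarrow> hlb list \<Rightarrow> nat \<Rightarrow> ((nat \<Rightarrow> complex) \<Rightarrow> real) \<Rightarrow> bool" where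
  "ample_height K r b Hs n h \<longleftrightarrow>
     (\<forall>y\<in>hom_coords K n. \<forall>l. l \<noteq> 0 \<and> l \<in> alg_closure_in_C K \<longrightarrow> h (\<lambda>i. l * y i) = h y) \<and>
     (\<exists>k\<ge>1::nat. \<exists>C. \<forall>y\<in>hom_coords K n.
        \<bar>h y - real k * moriwaki_height K r b Hs n y\<bar> \<le> C)"

definition affine_to_hom :: "complex^'n::finite \<Rightarrow> nat \<Rightarrow> complex" where
  "affine_to_hom x i = (if i = 0 then 1
     else if i \<le> CARD('n) then x $ from_nat_into UNIV (i - 1) else 0)"

definition bounded_height :: "(complex^'n::finite \<Rightarrow> complex^'n) \<Rightarrow> bool" where
  "bounded_height f \<longleftrightarrow> (\<exists>K r b Hs h.
     fin_gen_field K \<and>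
     (\<exists>F. f = poly_map F \<and> (\<forall>i m. Poly_Mapping.lookup (F i) m \<in> K)) \<and>
     (\<forall>P\<in>Pre f. \<forall>i. P $ i \<in> alg_closure_in_C K) \<and>
     nef_big_polarization K r b Hs \<and>
     ample_height K r b Hs CARD('n) h \<and>
     bdd_above ((\<lambda>P. h (affine_to_hom P)) ` Pre f))"

end

theory Submission
  imports Defs "HOL-Library.Function_Algebras"
begin

text \<open>
  The only consequence of bounded height that is needed is that every complex preperiodic point
  has coordinates in the algebraic closure of a finitely generated field, so that \<open>Pre f\<close> is
  countable.  A countable algebraic subset of \<open>C^n\<close> is finite: if a coordinate \<open>u\<close> omits
  uncountably many values \<open>c\<close> on it, then by the Nullstellensatz every such \<open>u - c\<close> is invertible
  modulo its ideal, and since the polynomial ring has countable dimension, these inverses are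
  linearly dependent, which makes \<open>u\<close> a root of a nonzero polynomial in one variable.  (The same
  argument proves the weak Nullstellensatz over \<open>C\<close>.)  Hence each \<open>{x. f^m x = f^l x}\<close> is finite.
  A map \<open>g\<close> that commutes with \<open>f\<close> preserves these sets, and by Zariski density a map of degree
  \<open>d\<close> is determined by its values on some finite set of preperiodic points.
\<close>

section \<open>Countability of the preperiodic points\<close>

text \<open>Every element of a generated field is the value of a formal expression in the field
  operations, and there are only countably many expressions over countably many generators.\<close>

datatype 'a field_term = Gen 'a | One | Neg "'a field_term" | Inv "'a field_term"
  | Add "'a field_term" "'a field_term" | Mult "'a field_term" "'a field_term"

instance field_term :: (countable) countable
  by countable_datatype

context ring
begin

text \<open>\<open>Inv\<close> may be applied to a term with value zero. The result is then some
  unspecified element, which is harmless because only the inclusion of the generated field in the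
  range is claimed.\<close>

primrec field_term_value :: "(nat \<Rightarrow> 'a) \<Rightarrow> nat field_term \<Rightarrow> 'a" where
  "field_term_value \<rho> (Gen i) = \<rho> i"
| "field_term_value \<rho> One = \<one>"
| "field_term_value \<rho> (Neg t) = \<ominus> field_term_value \<rho> t"
| "field_term_value \<rho> (Inv t) = inv (field_term_value \<rho> t)"
| "field_term_value \<rho> (Add t u) = field_term_value \<rho> t \<oplus> field_term_value \<rho> u"
| "field_term_value \<rho> (Mult t u) = field_term_value \<rho> t \<otimes> field_term_value \<rho> u"

lemma countable_generate_field:
  assumes "countable S"
  shows "countable (generate_field R S)"
proof -
  define \<rho> where "\<rho> = from_nat_into S"
  have "x \<in> range (field_term_value \<rho>)" if "x \<in> generate_field R S" for x
    using that
  proof induction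
    case one
    show ?case by (rule range_eqI[where x = One]) simp
  next
    case (incl s)
    then show ?case
      by (intro range_eqI[where x = "Gen (to_nat_on S s)"]) (simp add: \<rho>_def assms)
  next
    case (a_inv s)
    then obtain t where "s = field_term_value \<rho> t" by blast
    then show ?case by (intro range_eqI[where x = "Neg t"]) simp
  next
    case (m_inv s)
    then obtain t where "s = field_term_value \<rho> t" by blast
    then show ?case by (intro range_eqI[where x = "Inv t"]) simp
  next
    case (eng_add s1 s2)
    then obtain t u where "s1 = field_term_value \<rho> t" "s2 = field_term_value \<rho> u" by blast
    then show ?case by (intro range_eqI[where x = "Add t u"]) simp
  next
    case (eng_mult s1 s2)
    then obtain t u where "s1 = field_term_value \<rho> t" "s2 = field_term_value \<rho> u" by blast
    then show ?case by (intro range_eqI[where x = "Mult t u"]) simp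
  qed
  then have "generate_field R S \<subseteq> range (field_term_value \<rho>)" by blast
  then show ?thesis by (rule countable_subset) simp
qed

end

text \<open>Each such element is a root of one of countably many nonzero polynomials, and each of
  these has finitely many roots.\<close>

lemma (in domain) countable_algebraic_elements:
  assumes "subring K R" and "countable K"
  shows "countable {x \<in> carrier R. (algebraic over K) x}"
proof -
  have sub: "{x \<in> carrier R. (algebraic over K) x}
      \<subseteq> (\<Union>p\<in>{p \<in> carrier (K[X]). p \<noteq> []}. {x. is_root p x})"
  proof
    fix x assume x: "x \<in> {x \<in> carrier R. (algebraic over K) x}"
    then obtain p where "p \<in> carrier (K[X])" "p \<noteq> []" "eval p x = \<zero>"
      using algebraicE[OF assms(1)] by blast
    with x show "x \<in> (\<Union>p\<in>{p \<in> carrier (K[X]). p \<noteq> []}. {x. is_root p x})"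
      by (auto simp: is_root_def)
  qed
  have "countable {p \<in> carrier (K[X]). p \<noteq> []}"
  proof (rule countable_subset)
    \<comment> \<open>A polynomial over \<open>K\<close> is a list of coefficients in
      \<open>K\<close>, with the empty list as zero.\<close>
    show "{p \<in> carrier (K[X]). p \<noteq> []} \<subseteq> lists K"
      by (auto simp: univ_poly_def polynomial_def)
    show "countable (lists K)" using assms(2) by simp
  qed
  have "countable {x. is_root p x}" if "p \<in> carrier (K[X])" for p
    using that finite_number_of_roots carrier_polynomial_shell[OF assms(1)]
    by (blast intro: countable_finite)
  then have "countable (\<Union>p\<in>{p \<in> carrier (K[X]). p \<noteq> []}. {x. is_root p x})"
    using \<open>countable {p \<in> carrier (K[X]). p \<noteq> []}\<close> by (intro countable_UN) simp_all
  with sub show ?thesis by (rule countable_subset)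
qed

lemma countable_alg_closure_in_C:
  assumes "fin_gen_field K"
  shows "countable (alg_closure_in_C K)"
proof -
  interpret C: field CC by (rule field_from_type_algebra)
  have carrier: "carrier CC = UNIV" by (simp add: ring_of_type_algebra_def)
  obtain S where S: "finite S" "K = generate_field CC S"
    using assms by (auto simp: fin_gen_field_def)
  have "countable K" using S C.countable_generate_field by (simp add: countable_finite)
  moreover have "subring K CC"
    unfolding S(2) using C.generate_field_is_subfield[of S] by (simp add: carrier subfieldE(1))
  ultimately show ?thesis
    using C.countable_algebraic_elements by (simp add: alg_closure_in_C_def carrier)
qed

lemma countable_Pre:
  fixes f :: "complex^'n::finite \<Rightarrow> complex^'n"
  assumes "bounded_height f"
  shows "countable (Pre f)"
proof -
  obtain K where K: "fin_gen_field K" "\<forall>P\<in>Pre f. \<forall>i. P $ i \<in> alg_closure_in_C K"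
    using assms by (auto simp: bounded_height_def)
  have "countable (Pi\<^sub>E UNIV (\<lambda>_::'n. alg_closure_in_C K))"
    by (intro countable_PiE finite countable_alg_closure_in_C K(1))
  moreover have "($) ` Pre f \<subseteq> Pi\<^sub>E UNIV (\<lambda>_::'n. alg_closure_in_C K)"
    using K(2) by auto
  ultimately have "countable (($) ` Pre f)" by (rule countable_subset[rotated])
  then show ?thesis
    by (rule countable_image_inj_on) (simp add: inj_on_def vec_nth_inject)
qed

section \<open>Polynomial functions\<close>

interpretation cfun: vector_space "\<lambda>(c::complex) (p::'a \<Rightarrow> complex) x. c * p x"
  by unfold_locales (auto simp: fun_eq_iff algebra_simps)

text \<open>The span of a countable set is the union of the spans of its finite initial segments.
  Hence one of these contains \<open>q c\<close> for uncountably many \<open>c\<close>, more than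
  its dimension allows to be independent.\<close>

lemma exists_linear_relation:
  fixes q :: "'c \<Rightarrow> 'a \<Rightarrow> complex"
  assumes "uncountable C" and "countable B" and "q ` C \<subseteq> cfun.span B"
  obtains T a where "finite T" "T \<subseteq> C" "\<exists>c\<in>T. a c \<noteq> 0" "(\<Sum>c\<in>T. (\<lambda>x. a c * q c x)) = 0"
\<comment> \<open>Linear dependence speaks of sets, not of families. A repeated value gives the
  relation \<open>q c - q d = 0\<close> directly; otherwise indices and functions
  correspond.\<close>
proof (cases "inj_on q C")
  case False
  then obtain c d where cd: "c \<in> C" "d \<in> C" "c \<noteq> d" "q c = q d"
    by (auto simp: inj_on_def)
  show thesis
    by (rule that[of "{c, d}" "\<lambda>k. if k = c then 1 else -1"])
      (use cd in \<open>auto simp: fun_eq_iff\<close>)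
next
  case True
  define B' where "B' = (\<lambda>n. {b\<in>B. to_nat_on B b < n})"
  have finB': "finite (B' n)" for n
  proof (rule inj_on_finite)
    show "inj_on (to_nat_on B) (B' n)"
      using inj_on_to_nat_on[OF assms(2)] by (auto simp: B'_def intro: inj_on_subset)
    show "to_nat_on B ` B' n \<subseteq> {..<n}" by (auto simp: B'_def)
  qed simp
  have "\<exists>n. q c \<in> cfun.span (B' n)" if c: "c \<in> C" for c
  proof -
    obtain t r where t: "finite t" "t \<subseteq> B" "q c = (\<Sum>b\<in>t. (\<lambda>x. r b * b x))"
      using assms(3) c unfolding cfun.span_explicit by blast
    obtain n where "\<forall>b\<in>t. to_nat_on B b < n"
      using finite_nat_set_iff_bounded[of "to_nat_on B ` t"] t(1) by auto
    then have "t \<subseteq> B' n" using t(2) by (auto simp: B'_def)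
    then show ?thesis
      unfolding t(3) by (intro exI[of _ n] cfun.span_sum cfun.span_scale cfun.span_base) auto
  qed
  then have "C = (\<Union>n. {c\<in>C. q c \<in> cfun.span (B' n)})" by blast
  then obtain n where "uncountable {c\<in>C. q c \<in> cfun.span (B' n)}"
    using assms(1) by (metis (lifting) countable_UN countableI_type)
  then have "infinite {c\<in>C. q c \<in> cfun.span (B' n)}" using countable_finite by blast
  \<comment> \<open>One vector more than there are generators forces dependence.\<close>
  then obtain T where T: "finite T" "card T = Suc (card (B' n))" "T \<subseteq> {c\<in>C. q c \<in> cfun.span (B' n)}"
    using infinite_arbitrarily_large by blast
  have inj: "inj_on q T" using True T(3) by (auto intro: inj_on_subset)
  have "cfun.dependent (q ` T)"
  proof (rule ccontr)
    assume "\<not> cfun.dependent (q ` T)"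
    then have "card (q ` T) \<le> card (B' n)"
      using cfun.independent_span_bound[OF finB'] T(3) by blast
    then show False using T(2) inj by (simp add: card_image)
  qed
  then obtain u where u: "\<exists>v\<in>q ` T. u v \<noteq> 0" "(\<Sum>v\<in>q ` T. (\<lambda>x. u v * v x)) = 0"
    unfolding cfun.dependent_finite[OF finite_imageI[OF T(1)]] by blast
  show thesis
  proof (rule that[of T "\<lambda>c. u (q c)"])
    show "(\<Sum>c\<in>T. (\<lambda>x. u (q c) * q c x)) = 0"
      using u(2) by (simp add: sum.reindex[OF inj])
  qed (use T u(1) in auto)
qed

section \<open>The ring of polynomial functions\<close>

definition monomial_fun :: "('n::finite \<Rightarrow> nat) \<Rightarrow> complex^'n \<Rightarrow> complex" where
  "monomial_fun e x = (\<Prod>i\<in>UNIV. x $ i ^ e i)"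

text \<open>Polynomials are taken as functions, spanned by the countable family of monomials, so
  that countable dimension is built in.\<close>

definition polynomial_functions :: "(complex^'n::finite \<Rightarrow> complex) set" where
  "polynomial_functions = cfun.span (range monomial_fun)"

lemma monomial_fun_mult: "monomial_fun e * monomial_fun e' = monomial_fun (\<lambda>i. e i + e' i)"
  by (simp add: monomial_fun_def fun_eq_iff power_add prod.distrib)

named_theorems polyfun

lemma polynomial_functions_add [polyfun]:
  "p \<in> polynomial_functions \<Longrightarrow> q \<in> polynomial_functions \<Longrightarrow> p + q \<in> polynomial_functions"
  unfolding polynomial_functions_def by (rule cfun.span_add)

lemma polynomial_functions_diff [polyfun]:
  "p \<in> polynomial_functions \<Longrightarrow> q \<in> polynomial_functions \<Longrightarrow> p - q \<in> polynomial_functions"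
  unfolding polynomial_functions_def by (rule cfun.span_diff)

lemma polynomial_functions_zero [polyfun]: "0 \<in> polynomial_functions"
  unfolding polynomial_functions_def by (rule cfun.span_zero)

lemma polynomial_functions_scale [polyfun]:
  "p \<in> polynomial_functions \<Longrightarrow> (\<lambda>x. c * p x) \<in> polynomial_functions"
  unfolding polynomial_functions_def by (rule cfun.span_scale)

lemma polynomial_functions_monomial [polyfun]: "monomial_fun e \<in> polynomial_functions"
  unfolding polynomial_functions_def by (rule cfun.span_base) simp

lemma polynomial_functions_one [polyfun]: "1 \<in> polynomial_functions"
  using polynomial_functions_monomial[of "\<lambda>_. 0"]
  by (simp add: monomial_fun_def[abs_def] one_fun_def)

lemma polynomial_functions_const [polyfun]: "(\<lambda>_. c) \<in> polynomial_functions"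
  using polynomial_functions_scale[OF polynomial_functions_one, of c] by simp

lemma polynomial_functions_coord [polyfun]: "(\<lambda>x. x $ i) \<in> polynomial_functions"
proof -
  have "(\<lambda>x. x $ i) = monomial_fun (\<lambda>j. if j = i then 1 else 0)"
    by (auto simp: monomial_fun_def fun_eq_iff if_distrib prod.delta cong: if_cong)
  then show ?thesis by (simp add: polyfun)
qed

text \<open>Linearity in each factor, by induction over the span, reduces this to
  \<open>monomial_fun_mult\<close>.\<close>

lemma polynomial_functions_mult [polyfun]:
  assumes p: "p \<in> polynomial_functions" and q: "q \<in> polynomial_functions"
  shows "p * q \<in> polynomial_functions"
proof -
  have monomial: "monomial_fun e * q \<in> polynomial_functions" for e
    using q unfolding polynomial_functions_def[where 'n='a]
  proof (induction rule: cfun.span_induct_alt)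
    case base
    show ?case by (simp only: mult_zero_left mult_zero_right cfun.span_zero)
  next
    case (step c x y)
    then obtain e' where "x = monomial_fun e'" by blast
    then have "monomial_fun e * ((\<lambda>z. c * x z) + y)
        = (\<lambda>z. c * monomial_fun (\<lambda>i. e i + e' i) z) + monomial_fun e * y"
      by (simp add: fun_eq_iff algebra_simps flip: monomial_fun_mult)
    moreover have "\<dots> \<in> cfun.span (range monomial_fun)"
      by (intro cfun.span_add cfun.span_scale step cfun.span_base rangeI)
    ultimately show ?case by (simp only:)
  qed
  show ?thesis
    using p unfolding polynomial_functions_def[where 'n='a]
  proof (induction rule: cfun.span_induct_alt)
    case base
    show ?case by (simp only: mult_zero_left mult_zero_right cfun.span_zero)
  next
    case (step c x y)
    then obtain e where "x = monomial_fun e" by blast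
    then have "((\<lambda>z. c * x z) + y) * q = (\<lambda>z. c * (monomial_fun e * q) z) + y * q"
      by (simp add: fun_eq_iff algebra_simps)
    moreover have "\<dots> \<in> cfun.span (range monomial_fun)"
      using monomial[of e] unfolding polynomial_functions_def
      by (intro cfun.span_add cfun.span_scale step)
    ultimately show ?case by (simp only:)
  qed
qed

lemma polynomial_functions_sum [polyfun]:
  "(\<And>k. k \<in> A \<Longrightarrow> p k \<in> polynomial_functions) \<Longrightarrow> sum p A \<in> polynomial_functions"
  unfolding polynomial_functions_def by (rule cfun.span_sum)

lemma polynomial_functions_prod [polyfun]:
  "(\<And>k. k \<in> A \<Longrightarrow> p k \<in> polynomial_functions) \<Longrightarrow> prod p A \<in> polynomial_functions"
  by (induction A rule: infinite_finite_induct) (auto intro: polyfun)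

lemma polynomial_functions_power [polyfun]:
  "p \<in> polynomial_functions \<Longrightarrow> p ^ k \<in> polynomial_functions"
  by (induction k) (auto intro: polyfun)

lemma power_fun_apply [simp]: "(p ^ k) x = p x ^ k" for p :: "'a \<Rightarrow> complex"
  by (induction k) auto

lemma sum_fun_apply [simp]: "(sum p A) x = (\<Sum>k\<in>A. p k x)" for p :: "'b \<Rightarrow> 'a \<Rightarrow> complex"
  by (induction A rule: infinite_finite_induct) auto

lemma prod_fun_apply [simp]: "(prod p A) x = (\<Prod>k\<in>A. p k x)" for p :: "'b \<Rightarrow> 'a \<Rightarrow> complex"
  by (induction A rule: infinite_finite_induct) auto

lemma polynomial_functions_poly [polyfun]:
  assumes "u \<in> polynomial_functions"
  shows "(\<lambda>x. poly p (u x)) \<in> polynomial_functions"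
proof -
  have "(\<lambda>x. poly p (u x)) = (\<Sum>k\<le>Polynomial.degree p. (\<lambda>_. poly.coeff p k) * u ^ k)"
    by (simp add: fun_eq_iff poly_altdef)
  then show ?thesis using assms by (auto intro!: polyfun)
qed

text \<open>Substitution is linear in \<open>p\<close> and turns a monomial into a product of powers
  of the coordinates of \<open>f\<close>.\<close>

lemma polynomial_functions_compose:
  fixes f :: "complex^'m::finite \<Rightarrow> complex^'n::finite"
  assumes p: "p \<in> polynomial_functions" and f: "\<And>i. (\<lambda>x. f x $ i) \<in> polynomial_functions"
  shows "(\<lambda>x. p (f x)) \<in> polynomial_functions"
  using p unfolding polynomial_functions_def[where 'n='n]
proof (induction rule: cfun.span_induct_alt)
  case base
  show ?case using polynomial_functions_zero by (simp add: zero_fun_def)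
next
  case (step c x y)
  then obtain e where "x = monomial_fun e" by blast
  then have "(\<lambda>z. ((\<lambda>z. c * x z) + y) (f z))
      = (\<lambda>z. c * (\<Prod>i\<in>UNIV. (\<lambda>z. f z $ i) ^ e i) z) + (\<lambda>z. y (f z))"
    by (simp add: fun_eq_iff monomial_fun_def)
  also have "\<dots> \<in> polynomial_functions"
    by (intro polyfun f step)
  finally show ?case .
qed

section \<open>Countable algebraic sets\<close>

text \<open>The polynomial functions are a subset of a function type, so the ideal axioms are stated
  relative to that subset. Negatives come from multiplication by the constant -1.\<close>

definition polyfun_ideal :: "(complex^'n::finite \<Rightarrow> complex) set \<Rightarrow> bool" where
  "polyfun_ideal I \<longleftrightarrow> I \<subseteq> polynomial_functions \<and> 0 \<in> I \<and> (\<forall>p\<in>I. \<forall>q\<in>I. p + q \<in> I) \<and>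
     (\<forall>p\<in>polynomial_functions. \<forall>q\<in>I. p * q \<in> I)"

lemma polyfun_idealD:
  assumes "polyfun_ideal I"
  shows "p \<in> I \<Longrightarrow> p \<in> polynomial_functions"
    and "0 \<in> I"
    and "p \<in> I \<Longrightarrow> q \<in> I \<Longrightarrow> p + q \<in> I"
    and "p \<in> polynomial_functions \<Longrightarrow> q \<in> I \<Longrightarrow> p * q \<in> I"
  using assms by (auto simp: polyfun_ideal_def)

lemma polyfun_ideal_uminus:
  assumes "polyfun_ideal I" "p \<in> I"
  shows "- p \<in> I"
proof -
  have "(\<lambda>_. - 1) * p \<in> I" by (intro polyfun_idealD(4)[OF assms(1)] assms(2) polyfun)
  also have "(\<lambda>_. - 1) * p = - p" by (simp add: fun_eq_iff)
  finally show ?thesis .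
qed

lemma polyfun_ideal_diff:
  assumes "polyfun_ideal I" "p \<in> I" "q \<in> I"
  shows "p - q \<in> I"
  using polyfun_idealD(3)[OF assms(1,2) polyfun_ideal_uminus[OF assms(1,3)]] by simp

lemma polyfun_ideal_sum:
  assumes "polyfun_ideal I" "\<And>k. k \<in> A \<Longrightarrow> p k \<in> I"
  shows "sum p A \<in> I"
  using assms(2)
  by (induction A rule: infinite_finite_induct) (auto intro: polyfun_idealD[OF assms(1)])

text \<open>This is the ideal generated by \<open>I\<close> and \<open>u\<close>. Once
  \<open>1\<close> is shown to lie in it, the coefficient \<open>q\<close> is an inverse of
  \<open>u\<close> modulo \<open>I\<close>.\<close>

lemma polyfun_ideal_adjoin:
  assumes I: "polyfun_ideal I" and u: "u \<in> polynomial_functions"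
  shows "polyfun_ideal {p + q * u | p q. p \<in> I \<and> q \<in> polynomial_functions}" (is "polyfun_ideal ?J")
    and "I \<subseteq> {p + q * u | p q. p \<in> I \<and> q \<in> polynomial_functions}"
    and "u \<in> {p + q * u | p q. p \<in> I \<and> q \<in> polynomial_functions}"
proof -
  have member: "p + q * u \<in> ?J" if "p \<in> I" "q \<in> polynomial_functions" for p q
    using that by blast
  show sub: "I \<subseteq> ?J"
  proof
    fix p assume "p \<in> I"
    from member[OF this polynomial_functions_zero] show "p \<in> ?J"
      by (simp only: mult_zero_left add_0_right)
  qed
  show "u \<in> ?J"
    using member[OF polyfun_idealD(2)[OF I] polynomial_functions_one]
    by (simp only: mult_1_left add_0_left)
  show "polyfun_ideal ?J"
    unfolding polyfun_ideal_def
  proof (intro conjI ballI)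
    show "?J \<subseteq> polynomial_functions"
      using polyfun_idealD(1)[OF I] u by (auto intro!: polyfun)
    show "0 \<in> ?J" using sub polyfun_idealD(2)[OF I] by (rule subsetD)
  next
    fix f g assume "f \<in> ?J" "g \<in> ?J"
    then obtain p q p' q' where f: "f = p + q * u" "p \<in> I" "q \<in> polynomial_functions"
      and g: "g = p' + q' * u" "p' \<in> I" "q' \<in> polynomial_functions"
      by blast
    have "f + g = (p + p') + (q + q') * u" by (simp only: f g algebra_simps)
    also have "\<dots> \<in> ?J"
      by (intro member polyfun_idealD(3)[OF I] polynomial_functions_add f g)
    finally show "f + g \<in> ?J" .
  next
    fix h f :: "complex^'a \<Rightarrow> complex" assume h: "h \<in> polynomial_functions" and "f \<in> ?J"
    then obtain p q where f: "f = p + q * u" "p \<in> I" "q \<in> polynomial_functions"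
      by blast
    have "h * f = h * p + (h * q) * u" by (simp only: f algebra_simps)
    also have "\<dots> \<in> ?J"
      by (intro member polyfun_idealD(4)[OF I] polynomial_functions_mult f h)
    finally show "h * f \<in> ?J" .
  qed
qed

text \<open>
  A linear relation between the inverses \<open>q c\<close> of \<open>u - c\<close> modulo \<open>I\<close> exists because the polynomial
  functions have countable dimension; clearing denominators turns it into a polynomial relation for \<open>u\<close>.
\<close>

lemma exists_poly_in_ideal:
  assumes I: "polyfun_ideal I" and u: "u \<in> polynomial_functions" and C: "uncountable C"
    and inv: "\<And>c. c \<in> C \<Longrightarrow> \<exists>q\<in>polynomial_functions. q * (u - (\<lambda>_. c)) - 1 \<in> I"
  obtains p where "p \<noteq> 0" "(\<lambda>x. poly p (u x)) \<in> I"
proof -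
  obtain q where q: "\<And>c. c \<in> C \<Longrightarrow> q c \<in> polynomial_functions"
      "\<And>c. c \<in> C \<Longrightarrow> q c * (u - (\<lambda>_. c)) - 1 \<in> I"
    using inv by metis
  have "q ` C \<subseteq> cfun.span (range monomial_fun)"
    using q(1) by (auto simp: polynomial_functions_def)
  then obtain T a where T: "finite T" "T \<subseteq> C" "\<exists>c\<in>T. a c \<noteq> 0"
      "(\<Sum>c\<in>T. (\<lambda>x. a c * q c x)) = 0"
    by (rule exists_linear_relation[OF C countable_image[OF countableI_type]])
  \<comment> \<open>The numerator of the sum of \<open>a c / (X - c)\<close> over the common
    denominator; \<open>h c\<close> is its summand for \<open>c\<close>, evaluated at
    \<open>u\<close>.\<close>
  define p where "p = (\<Sum>c\<in>T. Polynomial.smult (a c) (\<Prod>k\<in>T - {c}. [:- k, 1:]))"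
  define h where "h c = (\<lambda>x. a c * poly (\<Prod>k\<in>T - {c}. [:- k, 1:]) (u x))" for c
  obtain c0 where c0: "c0 \<in> T" "a c0 \<noteq> 0" using T(3) by blast
  \<comment> \<open>At \<open>c0\<close> every summand with \<open>c\<close> different from
    \<open>c0\<close> contains the factor \<open>c0 - c0\<close>, so a single nonzero term
    survives.\<close>
  have "poly p c0 = (\<Sum>c\<in>T. a c * (\<Prod>k\<in>T - {c}. c0 - k))"
    by (simp add: p_def poly_sum poly_prod)
  also have "\<dots> = (\<Sum>c\<in>T. if c = c0 then a c0 * (\<Prod>k\<in>T - {c0}. c0 - k) else 0)"
  proof (rule sum.cong[OF refl])
    fix c assume "c \<in> T"
    then show "a c * (\<Prod>k\<in>T - {c}. c0 - k)
        = (if c = c0 then a c0 * (\<Prod>k\<in>T - {c0}. c0 - k) else 0)"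
      using T(1) c0(1) by (auto simp: prod_zero_iff)
  qed
  also have "\<dots> = a c0 * (\<Prod>k\<in>T - {c0}. c0 - k)" using T(1) c0(1) by simp
  also have "\<dots> \<noteq> 0" using T(1) c0(2) by (auto simp: prod_zero_iff)
  finally have "p \<noteq> 0" by auto
  \<comment> \<open>Here \<open>h c * (u - c)\<close> is \<open>a c\<close> times the full product
    over \<open>T\<close>, which does not depend on \<open>c\<close>. The linear relation therefore
    cancels the leading terms and leaves minus \<open>p\<close> evaluated at
    \<open>u\<close>.\<close>
  have "(\<Sum>c\<in>T. h c * (q c * (u - (\<lambda>_. c)) - 1)) \<in> I"
  proof (intro polyfun_ideal_sum[OF I] polyfun_idealD(4)[OF I] q(2))
    fix c assume "c \<in> T"
    then show "c \<in> C" using T(2) by blast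
    show "h c \<in> polynomial_functions" unfolding h_def by (intro polyfun u)
  qed
  also have "(\<Sum>c\<in>T. h c * (q c * (u - (\<lambda>_. c)) - 1)) = - (\<lambda>x. poly p (u x))"
  proof
    fix x
    have "h c x * (q c x * (u x - c)) = (\<Prod>k\<in>T. u x - k) * (a c * q c x)" if "c \<in> T" for c
      by (simp add: h_def poly_prod prod.remove[OF T(1) that, of "\<lambda>k. u x - k"] mult_ac)
    then have "(\<Sum>c\<in>T. h c x * (q c x * (u x - c))) = (\<Prod>k\<in>T. u x - k) * (\<Sum>c\<in>T. a c * q c x)"
      by (simp only: sum_distrib_left cong: sum.cong)
    also have "(\<Sum>c\<in>T. a c * q c x) = 0"
      using fun_cong[OF T(4), of x] by simp
    finally have "(\<Sum>c\<in>T. h c x * (q c x * (u x - c))) = 0" by simp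
    moreover have "(\<Sum>c\<in>T. h c x) = poly p (u x)" by (simp add: h_def p_def poly_sum)
    ultimately show "(\<Sum>c\<in>T. h c * (q c * (u - (\<lambda>_. c)) - 1)) x = (- (\<lambda>x. poly p (u x))) x"
      by (simp add: right_diff_distrib sum_subtractf)
  qed
  finally have "- (- (\<lambda>x. poly p (u x))) \<in> I" by (rule polyfun_ideal_uminus[OF I])
  then have "(\<lambda>x. poly p (u x)) \<in> I" by (simp only: minus_minus)
  with \<open>p \<noteq> 0\<close> show thesis by (rule that)
qed

section \<open>The weak Nullstellensatz\<close>

text \<open>Zorn's lemma applies: the union of a nonempty chain of ideals avoiding \<open>1\<close>
  is again an ideal avoiding \<open>1\<close>.\<close>

lemma exists_maximal_polyfun_ideal:
  assumes I: "polyfun_ideal I" "1 \<notin> I"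
  obtains M where "polyfun_ideal M" "I \<subseteq> M" "1 \<notin> M"
    "\<And>J. polyfun_ideal J \<Longrightarrow> M \<subseteq> J \<Longrightarrow> 1 \<notin> J \<Longrightarrow> J = M"
proof -
  define A where "A = {J. polyfun_ideal J \<and> I \<subseteq> J \<and> 1 \<notin> J}"
  have "\<exists>M\<in>A. \<forall>J\<in>A. M \<subseteq> J \<longrightarrow> J = M"
  proof (rule subset_Zorn_nonempty)
    show "A \<noteq> {}" using I by (auto simp: A_def)
    fix \<C> assume C: "\<C> \<noteq> {}" "subset.chain A \<C>"
    then have CA: "\<C> \<subseteq> A" by (auto simp: subset.chain_def)
    have "polyfun_ideal (\<Union>\<C>)"
      unfolding polyfun_ideal_def
    proof (intro conjI ballI)
      show "\<Union>\<C> \<subseteq> polynomial_functions" "0 \<in> \<Union>\<C>"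
        using CA C(1) by (auto simp: A_def polyfun_ideal_def)
      fix p q assume "p \<in> \<Union>\<C>" "q \<in> \<Union>\<C>"
      then obtain U V where UV: "U \<in> \<C>" "V \<in> \<C>" "p \<in> U" "q \<in> V" by blast
      then consider "U \<subseteq> V" | "V \<subseteq> U" using C(2) by (auto simp: subset_chain_def)
      then show "p + q \<in> \<Union>\<C>"
        using UV CA polyfun_idealD(3) unfolding A_def by cases blast+
    next
      fix p q :: "complex^'a \<Rightarrow> complex"
      assume "p \<in> polynomial_functions" "q \<in> \<Union>\<C>"
      then show "p * q \<in> \<Union>\<C>"
        using CA polyfun_idealD(4) unfolding A_def by blast
    qed
    then show "\<Union>\<C> \<in> A" using CA C(1) by (auto simp: A_def)
  qed
  then show thesis using that unfolding A_def by (metis (mono_tags, lifting) mem_Collect_eq subset_trans)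
qed

text \<open>Modulo a maximal ideal \<open>M\<close> containing \<open>I\<close> each coordinate is
  congruent to a constant, and these constants are the coordinates of the common zero.\<close>

theorem weak_nullstellensatz:
  fixes I :: "(complex^'n::finite \<Rightarrow> complex) set"
  assumes I: "polyfun_ideal I" "1 \<notin> I"
  obtains z where "\<And>p. p \<in> I \<Longrightarrow> p z = 0"
proof -
  obtain M where M: "polyfun_ideal M" "I \<subseteq> M" "1 \<notin> M"
    and max: "\<And>J. polyfun_ideal J \<Longrightarrow> M \<subseteq> J \<Longrightarrow> 1 \<notin> J \<Longrightarrow> J = M"
    by (rule exists_maximal_polyfun_ideal[OF I]) blast
  \<comment> \<open>Adjoining \<open>u\<close> to \<open>M\<close> must give the unit ideal, by
    maximality.\<close>
  have invertible: "\<exists>q\<in>polynomial_functions. q * u - 1 \<in> M"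
    if u: "u \<in> polynomial_functions" "u \<notin> M" for u
  proof -
    let ?J = "{p + q * u | p q. p \<in> M \<and> q \<in> polynomial_functions}"
    note J = polyfun_ideal_adjoin[OF M(1) u(1)]
    have "1 \<in> ?J"
    proof (rule ccontr)
      assume "1 \<notin> ?J"
      then have "?J = M" by (rule max[OF J(1,2)])
      with J(3) u(2) show False by blast
    qed
    then obtain p q where pq: "1 = p + q * u" "p \<in> M" "q \<in> polynomial_functions" by blast
    have "q * u - 1 = - p" unfolding pq(1) by simp
    with polyfun_ideal_uminus[OF M(1) pq(2)] pq(3) show ?thesis by metis
  qed
  \<comment> \<open>Otherwise every \<open>u - c\<close> is invertible modulo \<open>M\<close>, so a
    nonzero polynomial in \<open>u\<close> lies in \<open>M\<close>. Splitting off its linear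
    factors one by one leads to a nonzero constant in \<open>M\<close>.\<close>
  have "\<exists>c. (\<lambda>x. x $ i) - (\<lambda>_. c) \<in> M" for i :: 'n
  proof (rule ccontr)
    define u :: "complex^'n \<Rightarrow> complex" where "u = (\<lambda>x. x $ i)"
    assume "\<nexists>c. (\<lambda>x. x $ i) - (\<lambda>_. c) \<in> M"
    then have inv: "\<exists>q\<in>polynomial_functions. q * (u - (\<lambda>_. c)) - 1 \<in> M" for c
      unfolding u_def by (intro invertible polyfun) simp
    have u: "u \<in> polynomial_functions" unfolding u_def by (rule polyfun)
    obtain p where "p \<noteq> 0" "(\<lambda>x. poly p (u x)) \<in> M"
      by (rule exists_poly_in_ideal[OF M(1) u uncountable_UNIV_complex inv])
    then show False
    proof (induction "Polynomial.degree p" arbitrary: p)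
      case 0
      then obtain a where a: "p = [:a:]" by (metis degree_eq_zeroE)
      with 0 have "a \<noteq> 0" by auto
      have "(\<lambda>_. inverse a) * (\<lambda>x. poly p (u x)) \<in> M"
        by (intro polyfun_idealD(4)[OF M(1)] 0 polyfun)
      also have "(\<lambda>_. inverse a) * (\<lambda>x. poly p (u x)) = 1"
        using \<open>a \<noteq> 0\<close> by (simp add: a fun_eq_iff)
      finally show False using M(3) by blast
    next
      case (Suc n)
      then obtain c where "poly p c = 0"
        using fundamental_theorem_of_algebra[of p] by (metis constant_degree nat.distinct(1))
      then obtain r where r: "p = [:- c, 1:] * r" by (auto simp: poly_eq_0_iff_dvd)
      obtain q where q: "q \<in> polynomial_functions" "q * (u - (\<lambda>_. c)) - 1 \<in> M" using inv by blast
      let ?r = "\<lambda>x. poly r (u x)"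
      \<comment> \<open>As \<open>p = (X - c) * r\<close>, multiplying by the inverse
        \<open>q\<close> of \<open>u - c\<close> recovers \<open>r\<close> at \<open>u\<close>
        modulo \<open>M\<close>.\<close>
      have "q * (\<lambda>x. poly p (u x)) - ?r * (q * (u - (\<lambda>_. c)) - 1) \<in> M"
        by (intro polyfun_ideal_diff polyfun_idealD(4)[OF M(1)] Suc q M(1) polyfun u)
      also have "q * (\<lambda>x. poly p (u x)) - ?r * (q * (u - (\<lambda>_. c)) - 1) = ?r"
        by (simp add: fun_eq_iff r algebra_simps)
      finally have "?r \<in> M" .
      moreover have "r \<noteq> 0" using Suc(3) r by auto
      moreover have "n = Polynomial.degree r"
        using Suc(2) degree_mult_eq[of "[:- c, 1:]" r] \<open>r \<noteq> 0\<close> by (simp add: r del: mult_pCons_left)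
      ultimately show False using Suc(1) by blast
    qed
  qed
  then obtain z where z: "\<And>i. (\<lambda>x. x $ i) - (\<lambda>_. z i) \<in> M" by metis
  \<comment> \<open>Congruence to the value at \<open>z\<close> passes from coordinates through
    powers and products to monomials, and then by linearity to all polynomial functions.\<close>
  have cong: "p - (\<lambda>_. p (vec_lambda z)) \<in> M" if "p \<in> polynomial_functions" for p
    using that unfolding polynomial_functions_def
  proof (induction rule: cfun.span_induct_alt)
    case base
    have "(0::complex^'n \<Rightarrow> complex) - (\<lambda>_. 0 (vec_lambda z)) = 0" by (simp add: fun_eq_iff)
    then show ?case using polyfun_idealD(2)[OF M(1)] by (simp only:)
  next
    case (step c x y)
    have mult: "p * q - (\<lambda>_. (p * q) (vec_lambda z)) \<in> M"
      if p: "p - (\<lambda>_. p (vec_lambda z)) \<in> M" "p \<in> polynomial_functions"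
      and q: "q - (\<lambda>_. q (vec_lambda z)) \<in> M" for p q
    proof -
      have "p * (q - (\<lambda>_. q (vec_lambda z))) + (\<lambda>_. q (vec_lambda z)) * (p - (\<lambda>_. p (vec_lambda z))) \<in> M"
        by (intro polyfun_idealD(3,4)[OF M(1)] p q polyfun)
      also have "p * (q - (\<lambda>_. q (vec_lambda z))) + (\<lambda>_. q (vec_lambda z)) * (p - (\<lambda>_. p (vec_lambda z)))
          = p * q - (\<lambda>_. (p * q) (vec_lambda z))"
        by (simp add: fun_eq_iff algebra_simps)
      finally show ?thesis .
    qed
    have one: "1 - (\<lambda>_. 1 (vec_lambda z)) \<in> M"
    proof -
      have "(1::complex^'n \<Rightarrow> complex) - (\<lambda>_. 1 (vec_lambda z)) = 0" by (simp add: fun_eq_iff)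
      then show ?thesis using polyfun_idealD(2)[OF M(1)] by (simp only:)
    qed
    have coord: "(\<lambda>x. x $ i) - (\<lambda>_. (\<lambda>x. x $ i) (vec_lambda z)) \<in> M" for i
      using z by simp
    have power: "(\<lambda>x. x $ i) ^ k - (\<lambda>_. ((\<lambda>x. x $ i) ^ k) (vec_lambda z)) \<in> M" for i k
    proof (induction k)
      case 0
      show ?case unfolding power_0 by (rule one)
    next
      case (Suc k)
      show ?case unfolding power_Suc
        by (intro mult coord Suc polyfun)
    qed
    have "(\<Prod>i\<in>A. (\<lambda>x. x $ i) ^ e i) - (\<lambda>_. (\<Prod>i\<in>A. (\<lambda>x. x $ i) ^ e i) (vec_lambda z)) \<in> M"
      for e and A :: "'n set"
      using finite[of A]
    proof (induction A)
      case empty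
      show ?case unfolding prod.empty by (rule one)
    next
      case (insert i A)
      show ?case unfolding prod.insert[OF insert(1,2)]
        by (intro mult power insert polyfun)
    qed
    moreover from step(1) obtain e where "x = monomial_fun e" by blast
    then have "x = (\<Prod>i\<in>UNIV. (\<lambda>x. x $ i) ^ e i)"
      by (simp add: monomial_fun_def fun_eq_iff)
    ultimately have x: "x - (\<lambda>_. x (vec_lambda z)) \<in> M" by (simp only:)
    have "(\<lambda>_. c) * (x - (\<lambda>_. x (vec_lambda z))) + (y - (\<lambda>_. y (vec_lambda z))) \<in> M"
      by (intro polyfun_idealD(3,4)[OF M(1)] step x polyfun)
    also have "(\<lambda>_. c) * (x - (\<lambda>_. x (vec_lambda z))) + (y - (\<lambda>_. y (vec_lambda z)))
        = ((\<lambda>w. c * x w) + y) - (\<lambda>_. ((\<lambda>w. c * x w) + y) (vec_lambda z))"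
      by (simp add: fun_eq_iff algebra_simps)
    finally show ?case .
  qed
  have "p (vec_lambda z) = 0" if p: "p \<in> I" for p
  proof (rule ccontr)
    assume nz: "p (vec_lambda z) \<noteq> 0"
    have "p \<in> M" using p M(2) by blast
    \<comment> \<open>Both \<open>p\<close> and its difference from the constant \<open>p z\<close>
      lie in \<open>M\<close>, hence so does this nonzero constant.\<close>
    then have "(\<lambda>_. inverse (p (vec_lambda z))) * (p - (p - (\<lambda>_. p (vec_lambda z)))) \<in> M"
      by (intro polyfun_idealD(4) polyfun_ideal_diff cong polyfun M(1) polyfun_idealD(1)[OF M(1)])
    also have "(\<lambda>_. inverse (p (vec_lambda z))) * (p - (p - (\<lambda>_. p (vec_lambda z)))) = 1"
      using nz by (simp add: fun_eq_iff)
    finally show False using M(3) by blast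
  qed
  then show thesis by (rule that)
qed

section \<open>Finiteness of countable algebraic sets\<close>

text \<open>It suffices that each coordinate takes finitely many values, since \<open>E\<close>
  embeds in the product of its coordinate projections.\<close>

theorem finite_countable_zero_set:
  fixes E :: "(complex^'n::finite) set"
  assumes S: "S \<subseteq> polynomial_functions" and E: "E = {x. \<forall>p\<in>S. p x = 0}" and "countable E"
  shows "finite E"
proof -
  define I where "I = {p \<in> polynomial_functions. \<forall>x\<in>E. p x = 0}"
  have I: "polyfun_ideal I"
    unfolding polyfun_ideal_def I_def by (auto intro: polyfun)
  have "finite ((\<lambda>x. x $ i) ` E)" for i
  proof -
    define u :: "complex^'n \<Rightarrow> complex" where "u = (\<lambda>x. x $ i)"
    have u: "u \<in> polynomial_functions" unfolding u_def by (rule polyfun)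
    \<comment> \<open>A common zero of \<open>I\<close> and \<open>u - c\<close> would lie in
      \<open>E\<close>, because \<open>I\<close> contains the defining functions \<open>S\<close>,
      and would have \<open>u = c\<close>, a value that \<open>u\<close> omits on
      \<open>E\<close>.\<close>
    have inv: "\<exists>q\<in>polynomial_functions. q * (u - (\<lambda>_. c)) - 1 \<in> I" if c: "c \<in> UNIV - u ` E" for c
    proof -
      have uc: "u - (\<lambda>_. c) \<in> polynomial_functions" by (intro polyfun u)
      let ?J = "{p + q * (u - (\<lambda>_. c)) | p q. p \<in> I \<and> q \<in> polynomial_functions}"
      note J = polyfun_ideal_adjoin[OF I uc]
      have "1 \<in> ?J"
      proof (rule ccontr)
        assume "1 \<notin> ?J"
        then obtain z where z: "\<And>p. p \<in> ?J \<Longrightarrow> p z = 0" by (rule weak_nullstellensatz[OF J(1)]) blast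
        have "S \<subseteq> I" using S E by (auto simp: I_def)
        with J(2) z have "z \<in> E" unfolding E by blast
        moreover have "u z = c" using z[OF J(3)] by simp
        ultimately show False using c by blast
      qed
      then obtain p q where pq: "1 = p + q * (u - (\<lambda>_. c))" "p \<in> I" "q \<in> polynomial_functions"
        by blast
      have "q * (u - (\<lambda>_. c)) - 1 = - p" unfolding pq(1) by simp
      with polyfun_ideal_uminus[OF I pq(2)] pq(3) show ?thesis by metis
    qed
    have "uncountable (UNIV - u ` E)"
      using uncountable_minus_countable[OF uncountable_UNIV_complex] assms(3) by blast
    then obtain p where "p \<noteq> 0" "(\<lambda>x. poly p (u x)) \<in> I"
      using exists_poly_in_ideal[OF I u _ inv] by blast
    \<comment> \<open>Membership in the vanishing ideal \<open>I\<close> makes every value of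
      \<open>u\<close> on \<open>E\<close> a root of \<open>p\<close>.\<close>
    then have "(\<lambda>x. x $ i) ` E \<subseteq> {c. poly p c = 0}" by (auto simp: I_def u_def)
    then show ?thesis using poly_roots_finite[OF \<open>p \<noteq> 0\<close>] by (rule finite_subset)
  qed
  then have "finite (Pi\<^sub>E UNIV (\<lambda>i. (\<lambda>x. x $ i) ` E))" by (intro finite_PiE) auto
  moreover have "vec_nth ` E \<subseteq> Pi\<^sub>E UNIV (\<lambda>i. (\<lambda>x. x $ i) ` E)" by auto
  ultimately have "finite (vec_nth ` E)" by (rule finite_subset[rotated])
  then show ?thesis by (rule finite_imageD) (simp add: inj_on_def vec_nth_inject)
qed

section \<open>Commuting polynomial maps\<close>

text \<open>Cancellation can shrink the keys of a difference, so \<open>F\<close>, \<open>G\<close>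
  and \<open>F - G\<close> are compared over the union of the keys of \<open>F\<close> and
  \<open>G\<close>.\<close>

lemma mp_eval_superset:
  assumes "finite M" "Poly_Mapping.keys F \<subseteq> M"
  shows "mp_eval z F = (\<Sum>m\<in>M. Poly_Mapping.lookup F m *
    (\<Prod>v\<in>Poly_Mapping.keys m. z v ^ Poly_Mapping.lookup m v))"
  unfolding mp_eval_def using assms by (intro sum.mono_neutral_left) (auto simp: in_keys_iff)

lemma mp_eval_diff:
  fixes F G :: "('v, 'a::comm_ring_1) mp"
  shows "mp_eval z (F - G) = mp_eval z F - mp_eval z G"
proof -
  have "Poly_Mapping.keys (F - G) \<subseteq> Poly_Mapping.keys F \<union> Poly_Mapping.keys G"
    by (auto simp: in_keys_iff lookup_minus)
  then show ?thesis
    using mp_eval_superset[of "Poly_Mapping.keys F \<union> Poly_Mapping.keys G" _ z]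
    by (simp add: lookup_minus algebra_simps sum_subtractf)
qed

text \<open>Bounding each exponent separately already leaves finitely many monomials.\<close>

lemma mp_eval_in_span:
  fixes F :: "('n::finite, complex) mp"
  assumes "total_degree F \<le> d"
  shows "(\<lambda>x. mp_eval (($) x) F) \<in> cfun.span (monomial_fun ` {e. \<forall>i. e i \<le> d})"
proof -
  have monomial: "(\<lambda>x. \<Prod>v\<in>Poly_Mapping.keys m. x $ v ^ Poly_Mapping.lookup m v)
      = monomial_fun (Poly_Mapping.lookup m)" for m :: "'n \<Rightarrow>\<^sub>0 nat"
    unfolding monomial_fun_def
    by (intro ext prod.mono_neutral_left) (auto simp: in_keys_iff)
  have bound: "Poly_Mapping.lookup m i \<le> d" if m: "m \<in> Poly_Mapping.keys F" for m i
  proof (cases "i \<in> Poly_Mapping.keys m")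
    case True
    then have "Poly_Mapping.lookup m i \<le> (\<Sum>v\<in>Poly_Mapping.keys m. Poly_Mapping.lookup m v)"
      by (intro member_le_sum) auto
    also have "\<dots> \<le> total_degree F"
      unfolding total_degree_def using m by (intro Max_ge) auto
    finally show ?thesis using assms by simp
  qed (simp add: in_keys_iff)
  have "(\<lambda>x. mp_eval (($) x) F) = (\<Sum>m\<in>Poly_Mapping.keys F.
      (\<lambda>x. Poly_Mapping.lookup F m * monomial_fun (Poly_Mapping.lookup m) x))"
    by (simp add: mp_eval_def fun_eq_iff flip: monomial)
  also have "\<dots> \<in> cfun.span (monomial_fun ` {e. \<forall>i. e i \<le> d})"
    using bound by (intro cfun.span_sum cfun.span_scale cfun.span_base) auto
  finally show ?thesis .
qed

lemma polynomial_functions_poly_map [polyfun]: "(\<lambda>x. poly_map F x $ i) \<in> polynomial_functions"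
  using mp_eval_in_span[OF order_refl, of "F i"]
    cfun.span_mono[of "monomial_fun ` {e. \<forall>j. e j \<le> total_degree (F i)}" "range monomial_fun"]
  by (auto simp: poly_map_def polynomial_functions_def)

lemma polynomial_functions_funpow:
  "polynomial_map f \<Longrightarrow> (\<lambda>x. (f ^^ k) x $ i) \<in> polynomial_functions"
proof (induction k arbitrary: i)
  case (Suc k)
  then obtain F where "f = poly_map F" by (auto simp: polynomial_map_def)
  then show ?case
    using polynomial_functions_compose[OF polynomial_functions_poly_map[of F i], of "f ^^ k"] Suc by simp
qed (simp add: polyfun)

text \<open>The set is algebraic, cut out by the coordinates of the difference of the two iterates,
  and it is countable as a subset of \<open>Pre f\<close>.\<close>

lemma finite_preperiodic_type:
  fixes f :: "complex^'n::finite \<Rightarrow> complex^'n"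
  assumes "polynomial_map f" "bounded_height f" "m > l"
  shows "finite {x. (f ^^ m) x = (f ^^ l) x}" (is "finite ?E")
proof (rule finite_countable_zero_set)
  let ?S = "range (\<lambda>i. (\<lambda>x. (f ^^ m) x $ i) - (\<lambda>x. (f ^^ l) x $ i))"
  show "?S \<subseteq> polynomial_functions"
    using assms(1) by (auto intro!: polynomial_functions_diff polynomial_functions_funpow)
  show "?E = {x. \<forall>p\<in>?S. p x = 0}" by (auto simp: vec_eq_iff)
  have "?E \<subseteq> Pre f" using assms(3) by (auto simp: Pre_def)
  then show "countable ?E" using countable_Pre[OF assms(2)] by (rule countable_subset)
qed

section \<open>Finite determining sets and commuting maps\<close>

text \<open>Each new generator raises the dimension by at most one, and one further point of
  \<open>A\<close> makes up for it.\<close>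

lemma finite_determining_set:
  fixes B :: "('a \<Rightarrow> complex) set" and A :: "'a set"
  assumes "finite B"
  shows "\<exists>S\<subseteq>A. finite S \<and> (\<forall>p\<in>cfun.span B. (\<forall>x\<in>S. p x = 0) \<longrightarrow> (\<forall>x\<in>A. p x = 0))"
  using assms
proof (induction B)
  case empty
  show ?case by (intro exI[of _ "{}"]) simp
next
  case (insert b B)
  then obtain S where S: "S \<subseteq> A" "finite S"
    and det: "\<And>p x. p \<in> cfun.span B \<Longrightarrow> \<forall>x\<in>S. p x = 0 \<Longrightarrow> x \<in> A \<Longrightarrow> p x = 0"
    by metis
  show ?case
  proof (cases "\<forall>p\<in>cfun.span (insert b B). (\<forall>x\<in>S. p x = 0) \<longrightarrow> (\<forall>x\<in>A. p x = 0)")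
    case True
    with S show ?thesis by blast
  next
    case False
    \<comment> \<open>The function \<open>p0\<close> shows that \<open>S\<close> is too small for
      the larger span; \<open>z\<close> is the point to be added.\<close>
    then obtain p0 z where p0: "p0 \<in> cfun.span (insert b B)" "\<forall>x\<in>S. p0 x = 0"
      and z: "z \<in> A" "p0 z \<noteq> 0" by blast
    from p0(1) obtain k0 where k0: "p0 - (\<lambda>x. k0 * b x) \<in> cfun.span B"
      unfolding cfun.span_breakdown_eq by blast
    have "k0 \<noteq> 0"
    proof
      assume "k0 = 0"
      then have "p0 - (\<lambda>x. k0 * b x) = p0" by (simp add: fun_eq_iff)
      with k0 have "p0 \<in> cfun.span B" by (simp only:)
      from det[OF this p0(2) z(1)] z(2) show False by simp
    qed
    have "p x = 0" if p: "p \<in> cfun.span (insert b B)" "\<forall>x\<in>insert z S. p x = 0" and x: "x \<in> A" for p x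
    proof -
      from p(1) obtain k where k: "p - (\<lambda>x. k * b x) \<in> cfun.span B"
        unfolding cfun.span_breakdown_eq by blast
      \<comment> \<open>The factor \<open>k / k0\<close> cancels the \<open>b\<close> component, so
        \<open>r\<close> lies in the old span. It vanishes on \<open>S\<close>, hence on
        \<open>A\<close>, and its value at \<open>z\<close> forces \<open>k = 0\<close>.\<close>
      define r where "r = (\<lambda>x. p x - k / k0 * p0 x)"
      have "(p - (\<lambda>x. k * b x)) - (\<lambda>x. k / k0 * (p0 - (\<lambda>x. k0 * b x)) x) \<in> cfun.span B"
        by (intro cfun.span_diff cfun.span_scale k k0)
      also have "(p - (\<lambda>x. k * b x)) - (\<lambda>x. k / k0 * (p0 - (\<lambda>x. k0 * b x)) x) = r"
        using \<open>k0 \<noteq> 0\<close> by (simp add: fun_eq_iff r_def field_simps)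
      finally have r: "r y = 0" if "y \<in> A" for y
        using det[of r y] that p(2) p0(2) by (simp add: r_def)
      from r[OF z(1)] have "k = 0" using p(2) z(2) \<open>k0 \<noteq> 0\<close> by (simp add: r_def)
      with r[OF x] show ?thesis by (simp add: r_def)
    qed
    then have "\<forall>p\<in>cfun.span (insert b B). (\<forall>x\<in>insert z S. p x = 0) \<longrightarrow> (\<forall>x\<in>A. p x = 0)"
      by blast
    moreover have "insert z S \<subseteq> A" "finite (insert z S)" using S z(1) by auto
    ultimately show ?thesis by blast
  qed
qed

text \<open>The coordinates of a difference of two such maps lie in one finite-dimensional space.
  Vanishing on \<open>S\<close> gives vanishing on \<open>A\<close>, and density extends this to the
  whole space.\<close>

lemma zariski_dense_finite_determining_set:
  fixes A :: "(complex^'n::finite) set"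
  assumes "zariski_dense A"
  obtains S where "S \<subseteq> A" "finite S"
    "\<And>F G. tuple_degree F \<le> d \<Longrightarrow> tuple_degree G \<le> d \<Longrightarrow>
       (\<forall>x\<in>S. poly_map F x = poly_map G x) \<Longrightarrow> poly_map F = poly_map G"
proof -
  let ?B = "monomial_fun ` {e :: 'n \<Rightarrow> nat. \<forall>i. e i \<le> d}"
  have "{e :: 'n \<Rightarrow> nat. \<forall>i. e i \<le> d} = Pi\<^sub>E UNIV (\<lambda>_. {..d})" by auto
  then have "finite ?B" by (simp add: finite_PiE)
  then obtain S where S: "S \<subseteq> A" "finite S"
    and det: "\<And>p. p \<in> cfun.span ?B \<Longrightarrow> \<forall>x\<in>S. p x = 0 \<Longrightarrow> \<forall>x\<in>A. p x = 0"
    using finite_determining_set[of ?B A] by blast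
  show thesis
  proof (rule that[OF S])
    fix F G :: "'n \<Rightarrow> ('n, complex) mp"
    assume deg: "tuple_degree F \<le> d" "tuple_degree G \<le> d"
      and eq: "\<forall>x\<in>S. poly_map F x = poly_map G x"
    have "mp_eval (($) x) (F i - G i) = 0" for i x
    proof -
      have "total_degree (F i) \<le> d" "total_degree (G i) \<le> d"
        using deg by (auto simp: tuple_degree_def)
      then have "(\<lambda>x. mp_eval (($) x) (F i)) - (\<lambda>x. mp_eval (($) x) (G i)) \<in> cfun.span ?B"
        by (intro cfun.span_diff mp_eval_in_span)
      from det[OF this] eq have "\<forall>x\<in>A. mp_eval (($) x) (F i - G i) = 0"
        by (simp add: poly_map_def vec_eq_iff mp_eval_diff)
      then have "A \<subseteq> {x. \<forall>p\<in>{F i - G i}. mp_eval (($) x) p = 0}" by auto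
      moreover have "zariski_closed {x. \<forall>p\<in>{F i - G i}. mp_eval (($) x) p = 0}"
        unfolding zariski_closed_def by blast
      ultimately have "{x. \<forall>p\<in>{F i - G i}. mp_eval (($) x) p = 0} = UNIV"
        using assms unfolding zariski_dense_def by blast
      then show ?thesis by blast
    qed
    then show "poly_map F = poly_map G"
      by (simp add: poly_map_def fun_eq_iff vec_eq_iff mp_eval_diff)
  qed
qed

lemma commute_funpow:
  assumes "f \<circ> g = g \<circ> f"
  shows "(f ^^ k) (g x) = g ((f ^^ k) x)"
  using assms by (induction k) (simp_all add: fun_eq_iff)

theorem theorem4p2:
  fixes f :: "complex^'n::finite \<Rightarrow> complex^'n" and d :: nat
  assumes "polynomial_map f"
    and "bounded_height f"
    and "zariski_dense (Pre f)"
    and "d \<ge> 1"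
  shows "finite (Com f d)"
proof -
  obtain S where S: "S \<subseteq> Pre f" "finite S"
    and det: "\<And>F G. tuple_degree F \<le> d \<Longrightarrow> tuple_degree G \<le> d \<Longrightarrow>
       (\<forall>x\<in>S. poly_map F x = poly_map G x) \<Longrightarrow> poly_map F = poly_map G"
    by (rule zariski_dense_finite_determining_set[OF assms(3)]) blast
  have "\<forall>P\<in>S. \<exists>m l. m > l \<and> (f ^^ m) P = (f ^^ l) P" using S(1) by (auto simp: Pre_def)
  then obtain m l where ml: "\<And>P. P \<in> S \<Longrightarrow> m P > l P \<and> (f ^^ m P) P = (f ^^ l P) P" by metis
  \<comment> \<open>Each \<open>P\<close> has its own pair of exponents, and a commuting map sends
    \<open>P\<close> to a solution of the same equation, which leaves finitely many possible
    images.\<close>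
  let ?V = "Pi\<^sub>E S (\<lambda>P. {x. (f ^^ m P) x = (f ^^ l P) x})"
  have "finite ?V"
    using S(2) ml by (intro finite_PiE finite_preperiodic_type assms) auto
  moreover have "(\<lambda>g. restrict g S) ` Com f d \<subseteq> ?V"
    using ml by (auto simp: Com_def commute_funpow)
  ultimately have "finite ((\<lambda>g. restrict g S) ` Com f d)" by (rule finite_subset[rotated])
  moreover have "inj_on (\<lambda>g. restrict g S) (Com f d)"
  proof (rule inj_onI)
    fix g h assume "g \<in> Com f d" "h \<in> Com f d" and eq: "restrict g S = restrict h S"
    then obtain G H where "g = poly_map G" "tuple_degree G = d" "h = poly_map H" "tuple_degree H = d"
      by (auto simp: Com_def)
    moreover have "g x = h x" if "x \<in> S" for x
      using fun_cong[OF eq, of x] that by simp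
    ultimately show "g = h" using det by simp
  qed
  ultimately show ?thesis by (rule finite_imageD)
qed

end
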